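(* Let $\mathcal{M}_1=(E,\mathcal{I}_1)$ be a matroid of rank $r$ with set of bases $\mathcal{X}_1$, let $w:E\to\mathbb{Z}_{\ge0}$ and let $o:E\to\mathcal{C}=\{\eta_1,\dots,\eta_K\}$ be an assignment of ordered categories. Let $U=\{u\in\mathbb{Z}_{\ge0}^K:\sum_{i=1}^K u_i=r\}$. For $u\in U$ consider the problems $$\text{(P}_u^{=}):\ \min\, w(B)\ \text{ s.t. } c_i(B)=u_i,\ i=1,\dots,K,\ B\in\mathcal{X}_1,$$ $$\text{(P}_u^{\le}):\ \min\, w(B)\ \text{ s.t. } c^{\min}_i(B)\le u_{K-i+1},\ i=1,\dots,K,\ B\in\mathcal{X}_1.$$ Then the non-dominated set of (MMPO) can be determined by solving $(\mathrm{P}_u^{=})$ (or $(\mathrm{P}_u^{\le})$) for all $u\in U$ and filtering out all dominated outcome vectors; that is, if for each $u\in U$ for which the problem is feasible $B_u$ is any optimal solution of $(\mathrm{P}_u^{=})$ (respectively of $(\mathrm{P}_u^{\le})$), then the non-dominated set of (MMPO) equals the set of those vectors in $\{(w(B_u),o(B_u))\}_u$ that are not dominated, in the sense of (MMPO), by another vector in this collection. Moreover, the non-dominated sets of (MMPCmin) and (MMPCmax) are obtained from the non-dominated set of (MMPO) by further filtering out all lexicographically dominated outcome vectors; that is, rewriting each non-dominated outcome vector $(w(B),o(B))$ of (MMPO) as $(w(B),c^{\min}(B))$ (respectively $(w(B),c^{\max}(B))$), the non-dominated set of (MMPCmin) (respectively (MMPCmax)) consists exactly of those of the resulting vectors that are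 not dominated, in the sense of (MMPCmin) (respectively (MMPCmax)), by another of the resulting vectors.
   Context: Bases of a matroid on a finite ground set $E$ all have the same cardinality $r$. Objective functions: $w(B)=\sum_{e\in B}w(e)$. $\mathcal{C}=\{\eta_1,\dots,\eta_K\}$ is totally ordered by $\eta_i\prec\eta_j$ iff $i<j$, and $\eta_i\preceq\eta_j$ iff $i\le j$. For a basis $B$, $o(B)=(o_1(B),\dots,o_r(B))\in\mathcal{C}^r$ is the vector of categories of the elements of $B$ sorted in non-decreasing order. For $j=1,\dots,K$, $c_j(B)=|\{e\in B:o(e)=\eta_j\}|$, $c^{\max}_j(B)=c_j(B)$ and $c^{\min}_j(B)=c_{K-j+1}(B)$. The vectors $o(B)$, $c^{\min}(B)$, $c^{\max}(B)$ determine each other, so an outcome vector $(w(B),o(B))$ can be rewritten as $(w(B),c^{\min}(B))$ or $(w(B),c^{\max}(B))$. For real vectors, $y^1<_{\mathrm{lex}}y^2$ iff there is $k$ with $y^1_k<y^2_k$ and $y^1_i=y^2_i$ for $i<k$; $y^1\leqq_{\mathrm{lex}}y^2$ iff $y^1<_{\mathrm{lex}}y^2$ or $y^1=y^2$. Problems (over $B\in\mathcal{X}_1$) and dominance of outcome vectors: (MMPO): minimize $(w(B),o(B))$; $(w',o')$ dominates $(w'',o'')$ if $w'\le w''$, $o'_i\preceq o''_i$ for all $i$, and the two vectors differ. (MMPCmin): minimize $w(B)$ and lexicographically minimize $c^{\min}(B)$; $(w',c')$ dominates $(w'',c'')$ if $w'\le w''$, $c'\leqq_{\mathrm{lex}}c''$,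 and the two vectors differ. (MMPCmax): minimize $w(B)$ and lexicographically maximize $c^{\max}(B)$; $(w',c')$ dominates $(w'',c'')$ if $w'\le w''$, $c''\leqq_{\mathrm{lex}}c'$, and the two vectors differ. The non-dominated set of a problem is the set of outcome vectors of bases in $\mathcal{X}_1$ that are not dominated by the outcome vector of any basis in $\mathcal{X}_1$. *)

theory Defs
  imports "HOL-Library.Multiset" "HOL-Library.FuncSet"
begin

section \<open>Matroids\<close>

locale matroid =
  fixes E :: "'a set" and indep :: "'a set set"
  assumes finite_ground: "finite E"
    and indep_subset: "X \<in> indep \<Longrightarrow> X \<subseteq> E"
    and empty_indep: "{} \<in> indep"
    and hereditary: "X \<in> indep \<Longrightarrow> Y \<subseteq> X \<Longrightarrow> Y \<in> indep"
    and augmentation: "X \<in> indep \<Longrightarrow> Y \<in> indep \<Longrightarrow> card X < card Y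
      \<Longrightarrow> \<exists>e\<in>Y - X. insert e X \<in> indep"

definition bases :: "'a set set \<Rightarrow> 'a set set" where
  "bases indep = {B \<in> indep. \<forall>X\<in>indep. B \<subseteq> X \<longrightarrow> X = B}"

text \<open>The description in the next definition is proper by the lemma \<open>card_basis\<close> below.\<close>

definition matroid_rank :: "'a set set \<Rightarrow> nat" where
  "matroid_rank indep = (THE r. \<forall>B\<in>bases indep. card B = r)"

lemma (in matroid) card_bases_eq:
  assumes A: "A \<in> bases indep" and B: "B \<in> bases indep"
  shows "card A = card B"
proof -
  have *: "\<not> card X < card Y" if "X \<in> bases indep" "Y \<in> bases indep" for X Y
    using augmentation[of X Y] that by (auto simp: bases_def)
  show ?thesis using *[OF A B] *[OF B A] by simp
qed

lemma (in matroid) finite_indep: "finite indep"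
proof (rule finite_subset)
  show "indep \<subseteq> Pow E" using indep_subset by blast
  show "finite (Pow E)" using finite_ground by simp
qed

lemma (in matroid) bases_nonempty: "bases indep \<noteq> {}"
proof -
  have "indep \<noteq> {}" using empty_indep by blast
  from finite_has_maximal[OF finite_indep this] obtain B
    where "B \<in> indep" "\<And>X. X \<in> indep \<Longrightarrow> B \<subseteq> X \<Longrightarrow> B = X" by blast
  then have "B \<in> bases indep" unfolding bases_def by blast
  then show ?thesis by blast
qed

lemma (in matroid) card_basis:
  assumes "B \<in> bases indep"
  shows "card B = matroid_rank indep"
proof -
  have "matroid_rank indep = card B"
    unfolding matroid_rank_def
  proof (rule the_equality)
    show "\<forall>A\<in>bases indep. card A = card B" using card_bases_eq assms by blast
  qed (use assms in auto)
  then show ?thesis by simp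
qed

section \<open>Objectives\<close>

text \<open>
  The categories are \<open>\<eta> 1, \<dots>, \<eta> K\<close>, for an \<open>\<eta>\<close> that is strictly increasing on \<open>{1..K}\<close>, so
  that the order of the type \<open>'c\<close> restricted to the categories is the order of the indices.
  Vectors with \<open>K\<close> numerical components are functions in \<open>{1..K} \<rightarrow>\<^sub>E UNIV\<close>; the
  vector of sorted categories is a list, its components in the same order.
\<close>

definition sorted_cats :: "('a \<Rightarrow> 'c::linorder) \<Rightarrow> 'a set \<Rightarrow> 'c list" where
  "sorted_cats cat B = sorted_list_of_multiset (image_mset cat (mset_set B))"

definition cat_count :: "('a \<Rightarrow> 'c) \<Rightarrow> (nat \<Rightarrow> 'c) \<Rightarrow> 'a set \<Rightarrow> nat \<Rightarrow> nat" where
  "cat_count cat \<eta> B j = card {e \<in> B. cat e = \<eta> j}"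

definition cmax :: "('a \<Rightarrow> 'c) \<Rightarrow> (nat \<Rightarrow> 'c) \<Rightarrow> nat \<Rightarrow> 'a set \<Rightarrow> nat \<Rightarrow> nat" where
  "cmax cat \<eta> K B = (\<lambda>j\<in>{1..K}. cat_count cat \<eta> B j)"

definition cmin :: "('a \<Rightarrow> 'c) \<Rightarrow> (nat \<Rightarrow> 'c) \<Rightarrow> nat \<Rightarrow> 'a set \<Rightarrow> nat \<Rightarrow> nat" where
  "cmin cat \<eta> K B = (\<lambda>j\<in>{1..K}. cat_count cat \<eta> B (K - j + 1))"

text \<open>The three vectors of categories determine each other.\<close>

lemma sorted_cats_eq_iff:
  assumes fin: "finite A" "finite B"
    and cats: "cat \<in> A \<rightarrow> \<eta> ` {1..K}" "cat \<in> B \<rightarrow> \<eta> ` {1..K}"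
  shows sorted_cats_eq_iff_cmax:
      "sorted_cats cat A = sorted_cats cat B \<longleftrightarrow> cmax cat \<eta> K A = cmax cat \<eta> K B"
    and sorted_cats_eq_iff_cmin:
      "sorted_cats cat A = sorted_cats cat B \<longleftrightarrow> cmin cat \<eta> K A = cmin cat \<eta> K B"
proof -
  have cnt: "count (image_mset cat (mset_set X)) c = card {e \<in> X. cat e = c}" if "finite X" for X c
  proof -
    have "{x. x \<in># mset_set X \<and> cat x = c} = {e \<in> X. cat e = c}" using that by auto
    moreover have "cat -` {c} \<inter> X = {e \<in> X. cat e = c}" by auto
    ultimately show ?thesis using that by (simp add: count_image_mset)
  qed
  have "sorted_cats cat A = sorted_cats cat B \<longleftrightarrow>
      image_mset cat (mset_set A) = image_mset cat (mset_set B)"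
    unfolding sorted_cats_def by (metis mset_sorted_list_of_multiset)
  also have "\<dots> \<longleftrightarrow> (\<forall>c. card {e \<in> A. cat e = c} = card {e \<in> B. cat e = c})"
    using fin by (simp add: multiset_eq_iff cnt)
  also have "\<dots> \<longleftrightarrow> (\<forall>j\<in>{1..K}. cat_count cat \<eta> A j = cat_count cat \<eta> B j)" (is "_ \<longleftrightarrow> ?R")
  proof
    assume R: ?R
    show "\<forall>c. card {e \<in> A. cat e = c} = card {e \<in> B. cat e = c}"
    proof
      fix c
      show "card {e \<in> A. cat e = c} = card {e \<in> B. cat e = c}"
      proof (cases "c \<in> \<eta> ` {1..K}")
        case True
        then show ?thesis using R by (auto simp: cat_count_def)
      next
        case False
        then have "{e \<in> A. cat e = c} = {}" "{e \<in> B. cat e = c} = {}" using cats by (auto simp: Pi_def)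
        then show ?thesis by (simp only:)
      qed
    qed
  qed (simp add: cat_count_def)
  finally have main: "sorted_cats cat A = sorted_cats cat B \<longleftrightarrow> ?R" .
  have restrict_eq_iff: "restrict f I = restrict g I \<longleftrightarrow> (\<forall>j\<in>I. f j = g j)"
    for f g :: "nat \<Rightarrow> nat" and I
    by (metis restrict_apply' restrict_ext)
  have "cmax cat \<eta> K A = cmax cat \<eta> K B \<longleftrightarrow> ?R"
    unfolding cmax_def by (rule restrict_eq_iff)
  then show "sorted_cats cat A = sorted_cats cat B \<longleftrightarrow> cmax cat \<eta> K A = cmax cat \<eta> K B"
    using main by simp
  have "?R \<longleftrightarrow> (\<forall>j\<in>{1..K}. cat_count cat \<eta> A (K - j + 1) = cat_count cat \<eta> B (K - j + 1))"
    (is "_ \<longleftrightarrow> ?R'")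
  proof
    assume R': ?R'
    show ?R
    proof
      fix j assume j: "j \<in> {1..K}"
      then have mem: "K - j + 1 \<in> {1..K}" and eq: "K - (K - j + 1) + 1 = j" by auto
      show "cat_count cat \<eta> A j = cat_count cat \<eta> B j"
        using bspec[OF R' mem] unfolding eq .
    qed
  next
    assume R: ?R
    show ?R'
    proof
      fix j assume "j \<in> {1..K}"
      then have "K - j + 1 \<in> {1..K}" by auto
      then show "cat_count cat \<eta> A (K - j + 1) = cat_count cat \<eta> B (K - j + 1)"
        using R by (rule bspec[rotated])
    qed
  qed
  also have "\<dots> \<longleftrightarrow> cmin cat \<eta> K A = cmin cat \<eta> K B"
    unfolding cmin_def by (rule restrict_eq_iff[symmetric])
  finally show "sorted_cats cat A = sorted_cats cat B \<longleftrightarrow> cmin cat \<eta> K A = cmin cat \<eta> K B"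
    using main by simp
qed

section \<open>Dominance\<close>

definition lex_less :: "nat \<Rightarrow> (nat \<Rightarrow> 'n::linorder) \<Rightarrow> (nat \<Rightarrow> 'n) \<Rightarrow> bool" where
  "lex_less K x y \<longleftrightarrow> (\<exists>k\<in>{1..K}. x k < y k \<and> (\<forall>i\<in>{1..<k}. x i = y i))"

definition lex_le :: "nat \<Rightarrow> (nat \<Rightarrow> 'n::linorder) \<Rightarrow> (nat \<Rightarrow> 'n) \<Rightarrow> bool" where
  "lex_le K x y \<longleftrightarrow> lex_less K x y \<or> x = y"

definition dominates_ord :: "nat \<times> 'c::linorder list \<Rightarrow> nat \<times> 'c list \<Rightarrow> bool" where
  "dominates_ord y z \<longleftrightarrow> fst y \<le> fst z \<and> list_all2 (\<le>) (snd y) (snd z) \<and> y \<noteq> z"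

definition dominates_lexmin :: "nat \<Rightarrow> nat \<times> (nat \<Rightarrow> nat) \<Rightarrow> nat \<times> (nat \<Rightarrow> nat) \<Rightarrow> bool" where
  "dominates_lexmin K y z \<longleftrightarrow> fst y \<le> fst z \<and> lex_le K (snd y) (snd z) \<and> y \<noteq> z"

definition dominates_lexmax :: "nat \<Rightarrow> nat \<times> (nat \<Rightarrow> nat) \<Rightarrow> nat \<times> (nat \<Rightarrow> nat) \<Rightarrow> bool" where
  "dominates_lexmax K y z \<longleftrightarrow> fst y \<le> fst z \<and> lex_le K (snd z) (snd y) \<and> y \<noteq> z"

definition nondominated :: "('v \<Rightarrow> 'v \<Rightarrow> bool) \<Rightarrow> 'v set \<Rightarrow> 'v set" where
  "nondominated dominates Y = {y \<in> Y. \<not> (\<exists>y'\<in>Y. dominates y' y)}"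

section \<open>Problems\<close>

definition outcome_ord :: "('a \<Rightarrow> nat) \<Rightarrow> ('a \<Rightarrow> 'c::linorder) \<Rightarrow> 'a set \<Rightarrow> nat \<times> 'c list" where
  "outcome_ord w cat B = (sum w B, sorted_cats cat B)"

definition outcome_min ::
  "('a \<Rightarrow> nat) \<Rightarrow> ('a \<Rightarrow> 'c) \<Rightarrow> (nat \<Rightarrow> 'c) \<Rightarrow> nat \<Rightarrow> 'a set \<Rightarrow> nat \<times> (nat \<Rightarrow> nat)" where
  "outcome_min w cat \<eta> K B = (sum w B, cmin cat \<eta> K B)"

definition outcome_max ::
  "('a \<Rightarrow> nat) \<Rightarrow> ('a \<Rightarrow> 'c) \<Rightarrow> (nat \<Rightarrow> 'c) \<Rightarrow> nat \<Rightarrow> 'a set \<Rightarrow> nat \<times> (nat \<Rightarrow> nat)" where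
  "outcome_max w cat \<eta> K B = (sum w B, cmax cat \<eta> K B)"

definition nd_MMPO ::
  "'a set set \<Rightarrow> ('a \<Rightarrow> nat) \<Rightarrow> ('a \<Rightarrow> 'c::linorder) \<Rightarrow> (nat \<times> 'c list) set" where
  "nd_MMPO indep w cat = nondominated dominates_ord (outcome_ord w cat ` bases indep)"

definition nd_MMPCmin ::
  "'a set set \<Rightarrow> ('a \<Rightarrow> nat) \<Rightarrow> ('a \<Rightarrow> 'c) \<Rightarrow> (nat \<Rightarrow> 'c) \<Rightarrow> nat \<Rightarrow> (nat \<times> (nat \<Rightarrow> nat)) set" where
  "nd_MMPCmin indep w cat \<eta> K =
     nondominated (dominates_lexmin K) (outcome_min w cat \<eta> K ` bases indep)"

definition nd_MMPCmax ::
  "'a set set \<Rightarrow> ('a \<Rightarrow> nat) \<Rightarrow> ('a \<Rightarrow> 'c) \<Rightarrow> (nat \<Rightarrow> 'c) \<Rightarrow> nat \<Rightarrow> (nat \<times> (nat \<Rightarrow> nat)) set" where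
  "nd_MMPCmax indep w cat \<eta> K =
     nondominated (dominates_lexmax K) (outcome_max w cat \<eta> K ` bases indep)"

definition count_vectors :: "nat \<Rightarrow> nat \<Rightarrow> (nat \<Rightarrow> nat) set" where
  "count_vectors K r = {u \<in> {1..K} \<rightarrow>\<^sub>E UNIV. (\<Sum>i=1..K. u i) = r}"

definition feasible_eq ::
  "'a set set \<Rightarrow> ('a \<Rightarrow> 'c) \<Rightarrow> (nat \<Rightarrow> 'c) \<Rightarrow> nat \<Rightarrow> (nat \<Rightarrow> nat) \<Rightarrow> 'a set set" where
  "feasible_eq indep cat \<eta> K u =
     {B \<in> bases indep. \<forall>i\<in>{1..K}. cat_count cat \<eta> B i = u i}"

definition feasible_le ::
  "'a set set \<Rightarrow> ('a \<Rightarrow> 'c) \<Rightarrow> (nat \<Rightarrow> 'c) \<Rightarrow> nat \<Rightarrow> (nat \<Rightarrow> nat) \<Rightarrow> 'a set set" where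
  "feasible_le indep cat \<eta> K u =
     {B \<in> bases indep. \<forall>i\<in>{1..K}. cmin cat \<eta> K B i \<le> u (K - i + 1)}"

definition optimal :: "('a \<Rightarrow> nat) \<Rightarrow> 'a set set \<Rightarrow> 'a set \<Rightarrow> bool" where
  "optimal w F B \<longleftrightarrow> is_arg_min (sum w) (\<lambda>B. B \<in> F) B"

end

(*
  Since the categories of all elements of a basis B count up to r, the constraints of (P_u^<=) are tight,
  so both problems range over the bases with prescribed category vector, and each outcome is weakly
  dominated by an optimal outcome with the same category vector. If o(A) is componentwise at most o(B),
  then A has at least as many elements as B in each initial segment of the categories, hence at most
  as many in each final segment. Comparing these partial sums at the first component in which the
  count vectors differ turns componentwise into lexicographic dominance. In each case, discarding
  outcomes that are weakly dominated by remaining ones does not change the non-dominated set.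
*)

theory Submission
  imports Defs
begin

section \<open>Filtering by a transitive relation\<close>

text \<open>A non-dominated \<open>y\<close> of \<open>Y\<close> has no \<open>z\<close> dominating
  it, so the given \<open>z\<close> is \<open>y\<close> itself. Conversely, if some \<open>y\<close>
  in \<open>Y\<close> dominates an element of \<open>Z\<close>, then so does the \<open>z\<close>
  below \<open>y\<close>, by transitivity. Every filtering claim of the theorem reduces to
  this.\<close>

lemma nondominated_eq_subset:
  assumes "transp D" and "Z \<subseteq> Y" and below: "\<And>y. y \<in> Y \<Longrightarrow> \<exists>z\<in>Z. z = y \<or> D z y"
  shows "nondominated D Y = nondominated D Z"
proof
  show "nondominated D Y \<subseteq> nondominated D Z"
    using assms(2) below unfolding nondominated_def by blast
  show "nondominated D Z \<subseteq> nondominated D Y"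
    using assms(2) below transpD[OF assms(1)] unfolding nondominated_def by blast
qed

lemma ex_nondominated_below:
  assumes "transp D" "asymp D" "finite Y" "y \<in> Y"
  shows "\<exists>z\<in>nondominated D Y. z = y \<or> D z y"
proof -
  let ?A = "{z \<in> Y. z = y \<or> D z y}"
  have "\<exists>m\<in>?A. \<forall>x\<in>?A. x \<noteq> m \<longrightarrow> \<not> D x m"
    using assms by (intro Finite_Set.bex_min_element) (auto intro: asymp_on_subset transp_on_subset)
  then obtain m where m: "m \<in> ?A" "\<And>x. x \<in> ?A \<Longrightarrow> x \<noteq> m \<Longrightarrow> \<not> D x m" by blast
  \<comment> \<open>Such an \<open>x\<close> would lie in \<open>?A\<close> by transitivity and
    differ from \<open>m\<close> by asymmetry, against the minimality of \<open>m\<close>.\<close>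
  have "\<not> D x m" if "x \<in> Y" for x
    using that m transpD[OF assms(1)] asympD[OF assms(2)] by blast
  then show ?thesis using m(1) unfolding nondominated_def by blast
qed

section \<open>The dominance relations are transitive\<close>

text \<open>Common shape of the three dominance relations. The point to check is that a chain cannot
  close up: \<open>x = z\<close> would force \<open>x = y\<close> by antisymmetry in both
  components.\<close>

lemma transp_dominance:
  fixes R :: "'v \<Rightarrow> 'v \<Rightarrow> bool"
  assumes "transp R" "antisymp R"
  shows "transp (\<lambda>y z. fst y \<le> (fst z :: nat) \<and> R (snd y) (snd z) \<and> y \<noteq> z)"
proof (rule transpI)
  fix x y z :: "nat \<times> 'v"
  assume xy: "fst x \<le> fst y \<and> R (snd x) (snd y) \<and> x \<noteq> y"
    and yz: "fst y \<le> fst z \<and> R (snd y) (snd z) \<and> y \<noteq> z"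
  have "x \<noteq> z" using xy yz antisympD[OF assms(2)] by (metis antisym prod.expand)
  then show "fst x \<le> fst z \<and> R (snd x) (snd z) \<and> x \<noteq> z"
    using xy yz transpD[OF assms(1)] by (meson le_trans)
qed

lemma transp_list_all2_le: "transp (list_all2 ((\<le>) :: 'c::linorder \<Rightarrow> _))"
  by (rule transpI) (rule list_all2_trans[of "(\<le>)" "(\<le>)" "(\<le>)"], auto)

lemma antisymp_list_all2_le: "antisymp (list_all2 ((\<le>) :: 'c::linorder \<Rightarrow> _))"
  by (rule antisympI) (rule list_all2_antisym[of "(\<le>)" "(\<le>)"], auto)

lemma transp_dominates_ord: "transp dominates_ord"
  using transp_dominance[OF transp_list_all2_le antisymp_list_all2_le]
  unfolding dominates_ord_def[abs_def] .

lemma dominates_ord_irrefl: "\<not> dominates_ord y y"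
  by (simp add: dominates_ord_def)

lemma asymp_dominates_ord: "asymp dominates_ord"
  using transp_dominates_ord by (intro asympI) (blast dest: transpD intro: dominates_ord_irrefl[THEN notE])

lemma lex_less_trans: "lex_less K x y \<Longrightarrow> lex_less K y z \<Longrightarrow> lex_less K x z"
  unfolding lex_less_def
proof (elim bexE conjE)
  fix k l
  assume "k \<in> {1..K}" "x k < y k" "\<forall>i\<in>{1..<k}. x i = y i"
    and "l \<in> {1..K}" "y l < z l" "\<forall>i\<in>{1..<l}. y i = z i"
  \<comment> \<open>All three vectors agree before the smaller of the two first differences; there,
    one comparison is strict and the other is strict or an equality.\<close>
  then show "\<exists>k\<in>{1..K}. x k < z k \<and> (\<forall>i\<in>{1..<k}. x i = z i)"
    by (intro bexI[of _ "min k l"]) (auto simp: min_def; cases k l rule: linorder_cases; force)+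
qed

lemma lex_less_irrefl: "\<not> lex_less K x x"
  by (simp add: lex_less_def)

lemma transp_lex_le: "transp (lex_le K)"
  by (rule transpI) (auto simp: lex_le_def dest: lex_less_trans)

lemma antisymp_lex_le: "antisymp (lex_le K)"
  unfolding lex_le_def by (rule antisympI) (metis lex_less_trans lex_less_irrefl)

lemma transp_dominates_lexmin: "transp (dominates_lexmin K)"
  using transp_dominance[OF transp_lex_le antisymp_lex_le]
  unfolding dominates_lexmin_def[abs_def] .

lemma transp_dominates_lexmax: "transp (dominates_lexmax K)"
proof -
  have "transp (\<lambda>x y. lex_le K y x)" "antisymp (\<lambda>x y. lex_le K y x)"
    using transpD[OF transp_lex_le] antisympD[OF antisymp_lex_le]
    by (auto intro!: transpI antisympI)
  from transp_dominance[OF this] show ?thesis unfolding dominates_lexmax_def[abs_def] .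
qed

section \<open>From componentwise to lexicographic comparison\<close>

lemma lex_le_if_partial_sums_le:
  fixes x y :: "nat \<Rightarrow> nat"
  assumes ext: "x \<in> extensional {1..K}" "y \<in> extensional {1..K}"
    and le: "\<And>k. k \<in> {1..K} \<Longrightarrow> sum x {1..k} \<le> sum y {1..k}"
  shows "lex_le K x y"
proof (cases "x = y")
  case False
  \<comment> \<open>Extensionality ensures that distinct vectors differ at an index in
    \<open>{1..K}\<close>, where \<open>lex_less\<close> can see it.\<close>
  then have ex: "\<exists>k. k \<in> {1..K} \<and> x k \<noteq> y k" using extensionalityI[OF ext] by blast
  define k where "k = (LEAST k. k \<in> {1..K} \<and> x k \<noteq> y k)"
  have k: "k \<in> {1..K}" "x k \<noteq> y k" using LeastI_ex[OF ex] by (auto simp: k_def)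
  have eq: "x i = y i" if "i \<in> {1..<k}" for i
    using not_less_Least[of i "\<lambda>k. k \<in> {1..K} \<and> x k \<noteq> y k"] that k(1) by (auto simp: k_def)
  have "{1..k} = insert k {1..<k}" using k(1) by auto
  moreover have "sum x {1..<k} = sum y {1..<k}" using eq by (rule sum.cong[OF refl])
  ultimately have "x k \<le> y k" using le[OF k(1)] by simp
  then have "x k < y k" using k(2) by simp
  then show ?thesis using k(1) eq unfolding lex_le_def lex_less_def by blast
qed (simp add: lex_le_def)

text \<open>The partner of each kept entry is kept. With a threshold condition as \<open>P\<close>,
  componentwise comparison of sorted vectors becomes comparison of cardinalities.\<close>

lemma length_filter_mono_list_all2:
  assumes "list_all2 R xs ys" and "\<And>x y. R x y \<Longrightarrow> P x \<Longrightarrow> P y"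
  shows "length (filter P xs) \<le> length (filter P ys)"
  using assms(1) by induction (use assms(2) in auto)

lemma length_filter_sorted_cats:
  assumes "finite B"
  shows "length (filter P (sorted_cats cat B)) = card {e \<in> B. P (cat e)}"
proof -
  have "length (filter P (sorted_cats cat B)) = size (filter_mset P (image_mset cat (mset_set B)))"
    unfolding sorted_cats_def by (metis mset_filter mset_sorted_list_of_multiset size_mset)
  also have "\<dots> = card {e \<in> B. P (cat e)}"
    using assms by (simp add: filter_mset_image_mset filter_mset_mset_set)
  finally show ?thesis .
qed

lemma sum_card_fibres:
  assumes "finite I" "finite B" "inj_on f I"
  shows "(\<Sum>i\<in>I. card {e \<in> B. g e = f i}) = card {e \<in> B. g e \<in> f ` I}"
proof -
  have "card (\<Union>i\<in>I. {e \<in> B. g e = f i}) = (\<Sum>i\<in>I. card {e \<in> B. g e = f i})"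
    using assms by (intro card_UN_disjoint) (auto dest: inj_onD)
  moreover have "(\<Union>i\<in>I. {e \<in> B. g e = f i}) = {e \<in> B. g e \<in> f ` I}" by auto
  ultimately show ?thesis by simp
qed

context
  fixes \<eta> :: "nat \<Rightarrow> 'c::linorder" and cat :: "'a \<Rightarrow> 'c" and K :: nat
  assumes \<eta>: "strict_mono_on {1..K} \<eta>"
begin

lemma sum_cat_count:
  assumes "finite B" "cat \<in> B \<rightarrow> \<eta> ` {1..K}"
  shows "(\<Sum>i=1..K. cat_count cat \<eta> B i) = card B"
proof -
  have "{e \<in> B. cat e \<in> \<eta> ` {1..K}} = B" using assms(2) by auto
  then show ?thesis
    using sum_card_fibres[OF _ assms(1) strict_mono_on_imp_inj_on[OF \<eta>], of cat]
    by (simp add: cat_count_def)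
qed

lemma sum_cmax:
  assumes "finite B" "cat \<in> B \<rightarrow> \<eta> ` {1..K}" "k \<in> {1..K}"
  shows "sum (cmax cat \<eta> K B) {1..k} = card {e \<in> B. cat e \<le> \<eta> k}"
proof -
  have "sum (cmax cat \<eta> K B) {1..k} = (\<Sum>i\<in>{1..k}. card {e \<in> B. cat e = \<eta> i})"
    using assms(3) by (intro sum.cong) (auto simp: cmax_def cat_count_def)
  also have "\<dots> = card {e \<in> B. cat e \<in> \<eta> ` {1..k}}"
    using assms(1,3) strict_mono_on_imp_inj_on[OF \<eta>]
    by (intro sum_card_fibres) (auto intro: inj_on_subset)
  also have "{e \<in> B. cat e \<in> \<eta> ` {1..k}} = {e \<in> B. cat e \<le> \<eta> k}"
  proof -
    \<comment> \<open>Stated for values of \<open>\<eta>\<close> on \<open>{1..K}\<close> only: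
      other elements of the type may lie below \<open>\<eta> k\<close> without being
      categories.\<close>
    have "\<eta> i \<in> \<eta> ` {1..k} \<longleftrightarrow> \<eta> i \<le> \<eta> k" if "i \<in> {1..K}" for i
      using that assms(3) inj_on_image_mem_iff[OF strict_mono_on_imp_inj_on[OF \<eta>], of i "{1..k}"]
      by (simp add: strict_mono_on_less_eq[OF \<eta>])
    then have "cat e \<in> \<eta> ` {1..k} \<longleftrightarrow> cat e \<le> \<eta> k" if "e \<in> B" for e
      using funcset_mem[OF assms(2) that] by (elim imageE) (simp only:)
    then show ?thesis by blast
  qed
  finally show ?thesis .
qed

lemma sum_cmin:
  assumes "finite B" "cat \<in> B \<rightarrow> \<eta> ` {1..K}" "k \<in> {1..K}"
  shows "sum (cmin cat \<eta> K B) {1..k} = card {e \<in> B. \<eta> (K - k + 1) \<le> cat e}"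
proof -
  let ?j = "K - k + 1"
  have "sum (cmin cat \<eta> K B) {1..k} = (\<Sum>i\<in>{1..k}. card {e \<in> B. cat e = \<eta> (K - i + 1)})"
    using assms(3) by (intro sum.cong) (auto simp: cmin_def cat_count_def)
  \<comment> \<open>The reversal \<open>i \<mapsto> K - i + 1\<close> is its own inverse and carries
    \<open>{1..k}\<close> onto the last \<open>k\<close> indices, which start at
    \<open>?j\<close>.\<close>
  also have "\<dots> = (\<Sum>i\<in>{?j..K}. card {e \<in> B. cat e = \<eta> i})"
    using assms(3) by (intro sum.reindex_bij_witness[of _ "\<lambda>i. K - i + 1" "\<lambda>i. K - i + 1"]) auto
  also have "\<dots> = card {e \<in> B. cat e \<in> \<eta> ` {?j..K}}"
    using assms(1,3) strict_mono_on_imp_inj_on[OF \<eta>]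
    by (intro sum_card_fibres) (auto intro: inj_on_subset)
  also have "{e \<in> B. cat e \<in> \<eta> ` {?j..K}} = {e \<in> B. \<eta> ?j \<le> cat e}"
  proof -
    have "\<eta> i \<in> \<eta> ` {?j..K} \<longleftrightarrow> \<eta> ?j \<le> \<eta> i" if "i \<in> {1..K}" for i
      using that assms(3) inj_on_image_mem_iff[OF strict_mono_on_imp_inj_on[OF \<eta>], of i "{?j..K}"]
      by (auto simp: strict_mono_on_less_eq[OF \<eta>])
    then have "cat e \<in> \<eta> ` {?j..K} \<longleftrightarrow> \<eta> ?j \<le> cat e" if "e \<in> B" for e
      using funcset_mem[OF assms(2) that] by (elim imageE) (simp only:)
    then show ?thesis by blast
  qed
  finally show ?thesis .
qed

lemma
  assumes le: "list_all2 (\<le>) (sorted_cats cat A) (sorted_cats cat B)"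
    and A: "finite A" "cat \<in> A \<rightarrow> \<eta> ` {1..K}"
    and B: "finite B" "cat \<in> B \<rightarrow> \<eta> ` {1..K}"
  shows lex_le_cmin: "lex_le K (cmin cat \<eta> K A) (cmin cat \<eta> K B)"
    and lex_le_cmax: "lex_le K (cmax cat \<eta> K B) (cmax cat \<eta> K A)"
proof -
  show "lex_le K (cmin cat \<eta> K A) (cmin cat \<eta> K B)"
  proof (rule lex_le_if_partial_sums_le)
    fix k assume k: "k \<in> {1..K}"
    show "sum (cmin cat \<eta> K A) {1..k} \<le> sum (cmin cat \<eta> K B) {1..k}"
      using length_filter_mono_list_all2[OF le, of "\<lambda>c. \<eta> (K - k + 1) \<le> c"] A(1) B(1)
      unfolding sum_cmin[OF A k] sum_cmin[OF B k] by (force simp: length_filter_sorted_cats)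
  qed (simp_all add: cmin_def)
  \<comment> \<open>Lower segments of categories are inherited by smaller entries, so for
    \<open>cmax\<close> the comparison is read from \<open>B\<close> to \<open>A\<close>; the upper
    segments used for \<open>cmin\<close> pass from \<open>A\<close> to \<open>B\<close>.\<close>
  have ge: "list_all2 (\<lambda>x y. y \<le> x) (sorted_cats cat B) (sorted_cats cat A)"
    using le by (simp add: list_all2_conv_all_nth)
  show "lex_le K (cmax cat \<eta> K B) (cmax cat \<eta> K A)"
  proof (rule lex_le_if_partial_sums_le)
    fix k assume k: "k \<in> {1..K}"
    show "sum (cmax cat \<eta> K B) {1..k} \<le> sum (cmax cat \<eta> K A) {1..k}"
      using length_filter_mono_list_all2[OF ge, of "\<lambda>c. c \<le> \<eta> k"] A(1) B(1)
      unfolding sum_cmax[OF A k] sum_cmax[OF B k] by (force simp: length_filter_sorted_cats)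
  qed (simp_all add: cmax_def)
qed

end

section \<open>Bases and the filtering claims\<close>

context matroid
begin

lemma finite_basis: "B \<in> bases indep \<Longrightarrow> finite B"
  using finite_subset[OF indep_subset finite_ground] by (auto simp: bases_def)

lemma finite_bases: "finite (bases indep)"
  using finite_indep by (rule rev_finite_subset) (auto simp: bases_def)

context
  fixes w :: "'a \<Rightarrow> nat" and \<eta> :: "nat \<Rightarrow> 'c::linorder" and cat :: "'a \<Rightarrow> 'c" and K :: nat
  assumes \<eta>: "strict_mono_on {1..K} \<eta>" and cat: "cat \<in> E \<rightarrow> \<eta> ` {1..K}"
begin

lemma cat_basis: "B \<in> bases indep \<Longrightarrow> cat \<in> B \<rightarrow> \<eta> ` {1..K}"
  using cat indep_subset by (auto simp: bases_def Pi_iff)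

lemma sum_cat_count_basis:
  "B \<in> bases indep \<Longrightarrow> (\<Sum>i=1..K. cat_count cat \<eta> B i) = matroid_rank indep"
  using sum_cat_count[OF \<eta> finite_basis cat_basis] card_basis by simp

lemma feasible_le_eq_feasible_eq:
  assumes u: "u \<in> count_vectors K (matroid_rank indep)"
  shows "feasible_le indep cat \<eta> K u = feasible_eq indep cat \<eta> K u"
proof -
  have "(\<forall>i\<in>{1..K}. cmin cat \<eta> K B i \<le> u (K - i + 1)) \<longleftrightarrow>
      (\<forall>i\<in>{1..K}. cat_count cat \<eta> B i = u i)" (is "?L \<longleftrightarrow> ?R") if B: "B \<in> bases indep" for B
  proof
    assume L: ?L
    \<comment> \<open>The constraint at \<open>K - i + 1\<close> undoes the reversal inside
      \<open>cmin\<close> and bounds the number of elements of category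
      \<open>\<eta> i\<close>.\<close>
    have le: "cat_count cat \<eta> B i \<le> u i" if i: "i \<in> {1..K}" for i
      using bspec[OF L, of "K - i + 1"] i by (auto simp: cmin_def)
    show ?R
    proof (rule ccontr)
      assume "\<not> ?R"
      then obtain i where "i \<in> {1..K}" "cat_count cat \<eta> B i < u i" using le by (meson le_neq_implies_less)
      then have "(\<Sum>i=1..K. cat_count cat \<eta> B i) < (\<Sum>i=1..K. u i)"
        using le by (intro sum_strict_mono_ex1) auto
      then show False using sum_cat_count_basis[OF B] u by (simp add: count_vectors_def)
    qed
  next
    assume R: ?R
    show ?L
    proof
      fix i assume "i \<in> {1..K}"
      then show "cmin cat \<eta> K B i \<le> u (K - i + 1)"
        using bspec[OF R, of "K - i + 1"] by (auto simp: cmin_def)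
    qed
  qed
  then show ?thesis unfolding feasible_le_def feasible_eq_def by blast
qed

text \<open>\<open>S\<close> picks an arbitrary optimum for each feasible \<open>u\<close>; its
  values at infeasible \<open>u\<close> never enter the collection.\<close>

lemma nd_MMPO_eq_optimal:
  assumes S: "\<And>u. u \<in> count_vectors K (matroid_rank indep) \<Longrightarrow> feasible_eq indep cat \<eta> K u \<noteq> {} \<Longrightarrow>
      optimal w (feasible_eq indep cat \<eta> K u) (S u)"
  shows "nd_MMPO indep w cat = nondominated dominates_ord
    {outcome_ord w cat (S u) | u.
       u \<in> count_vectors K (matroid_rank indep) \<and> feasible_eq indep cat \<eta> K u \<noteq> {}}"
  unfolding nd_MMPO_def
proof (rule nondominated_eq_subset[OF transp_dominates_ord])
  let ?Z = "{outcome_ord w cat (S u) | u.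
     u \<in> count_vectors K (matroid_rank indep) \<and> feasible_eq indep cat \<eta> K u \<noteq> {}}"
  show "?Z \<subseteq> outcome_ord w cat ` bases indep"
    using S by (fastforce simp: optimal_def is_arg_min_def feasible_eq_def)
  fix y assume "y \<in> outcome_ord w cat ` bases indep"
  then obtain B where B: "B \<in> bases indep" and y: "y = outcome_ord w cat B" by blast
  \<comment> \<open>The count vector of \<open>B\<close> itself, so that \<open>B\<close> competes
    with \<open>S u\<close> and cannot have smaller weight.\<close>
  define u where "u = cmax cat \<eta> K B"
  have u: "u \<in> count_vectors K (matroid_rank indep)"
    using sum_cat_count_basis[OF B] by (auto simp: u_def cmax_def count_vectors_def)
  have Bf: "B \<in> feasible_eq indep cat \<eta> K u"
    using B by (auto simp: feasible_eq_def u_def cmax_def)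
  then have opt: "optimal w (feasible_eq indep cat \<eta> K u) (S u)" using S[OF u] by blast
  then have Sb: "S u \<in> bases indep" and Su: "\<And>i. i \<in> {1..K} \<Longrightarrow> cat_count cat \<eta> (S u) i = u i"
    and wle: "sum w (S u) \<le> sum w B"
    using Bf by (auto simp: optimal_def is_arg_min_def feasible_eq_def not_less)
  have "cmax cat \<eta> K (S u) = cmax cat \<eta> K B"
    unfolding u_def[symmetric] using Su u
    by (intro extensionalityI[of _ "{1..K}"]) (auto simp: cmax_def count_vectors_def PiE_def)
  then have "sorted_cats cat (S u) = sorted_cats cat B"
    using sorted_cats_eq_iff_cmax finite_basis cat_basis Sb B by metis
  then have "outcome_ord w cat (S u) = y \<or> dominates_ord (outcome_ord w cat (S u)) y"
    using wle by (auto simp: y outcome_ord_def dominates_ord_def intro: list_all2_refl)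
  then show "\<exists>z\<in>?Z. z = y \<or> dominates_ord z y" using u Bf by blast
qed

text \<open>There are finitely many outcomes, so a non-dominated one equals or dominates that of
  \<open>B\<close>. Splitting this into weight and categories leaves only the categories to be
  translated into lexicographic terms.\<close>

lemma ex_nd_MMPO_below:
  assumes "B \<in> bases indep"
  obtains A where "A \<in> bases indep" "outcome_ord w cat A \<in> nd_MMPO indep w cat"
    "sum w A \<le> sum w B" "list_all2 (\<le>) (sorted_cats cat A) (sorted_cats cat B)"
proof -
  obtain z where z: "z \<in> nd_MMPO indep w cat"
      "z = outcome_ord w cat B \<or> dominates_ord z (outcome_ord w cat B)"
    using ex_nondominated_below[OF transp_dominates_ord asymp_dominates_ord,
        of "outcome_ord w cat ` bases indep" "outcome_ord w cat B"] assms finite_bases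
    by (auto simp: nd_MMPO_def)
  moreover obtain A where "A \<in> bases indep" "z = outcome_ord w cat A"
    using z(1) by (auto simp: nd_MMPO_def nondominated_def)
  ultimately show thesis
    by (intro that[of A]) (auto simp: outcome_ord_def dominates_ord_def intro: list_all2_refl)
qed

text \<open>Since \<open>sorted_cats\<close> and \<open>cmin\<close> determine each other on bases,
  the collection is the rewritten non-dominated set of (MMPO). The basis from
  \<open>ex_nd_MMPO_below\<close> is weakly better lexicographically too, so no other outcomes are
  needed.\<close>

lemma nd_MMPCmin_eq:
  "nd_MMPCmin indep w cat \<eta> K = nondominated (dominates_lexmin K)
    {outcome_min w cat \<eta> K B | B. B \<in> bases indep \<and> outcome_ord w cat B \<in> nd_MMPO indep w cat}"
  (is "_ = nondominated _ ?Z")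
  unfolding nd_MMPCmin_def
proof (rule nondominated_eq_subset[OF transp_dominates_lexmin])
  fix y assume "y \<in> outcome_min w cat \<eta> K ` bases indep"
  then obtain B where B: "B \<in> bases indep" and y: "y = outcome_min w cat \<eta> K B" by blast
  from ex_nd_MMPO_below[OF B] obtain A where A: "A \<in> bases indep"
      "outcome_ord w cat A \<in> nd_MMPO indep w cat" "sum w A \<le> sum w B"
      "list_all2 (\<le>) (sorted_cats cat A) (sorted_cats cat B)" .
  have "lex_le K (cmin cat \<eta> K A) (cmin cat \<eta> K B)"
    using lex_le_cmin[OF \<eta> A(4)] A(1) B finite_basis cat_basis by blast
  then show "\<exists>z\<in>?Z. z = y \<or> dominates_lexmin K z y"
    using A by (intro bexI[of _ "outcome_min w cat \<eta> K A"])
      (auto simp: y outcome_min_def dominates_lexmin_def)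
qed blast

lemma nd_MMPCmax_eq:
  "nd_MMPCmax indep w cat \<eta> K = nondominated (dominates_lexmax K)
    {outcome_max w cat \<eta> K B | B. B \<in> bases indep \<and> outcome_ord w cat B \<in> nd_MMPO indep w cat}"
  (is "_ = nondominated _ ?Z")
  unfolding nd_MMPCmax_def
proof (rule nondominated_eq_subset[OF transp_dominates_lexmax])
  fix y assume "y \<in> outcome_max w cat \<eta> K ` bases indep"
  then obtain B where B: "B \<in> bases indep" and y: "y = outcome_max w cat \<eta> K B" by blast
  from ex_nd_MMPO_below[OF B] obtain A where A: "A \<in> bases indep"
      "outcome_ord w cat A \<in> nd_MMPO indep w cat" "sum w A \<le> sum w B"
      "list_all2 (\<le>) (sorted_cats cat A) (sorted_cats cat B)" .
  \<comment> \<open>\<open>A\<close> is the better basis and stands on the right, as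
    \<open>cmax\<close> is maximized.\<close>
  have "lex_le K (cmax cat \<eta> K B) (cmax cat \<eta> K A)"
    using lex_le_cmax[OF \<eta> A(4)] A(1) B finite_basis cat_basis by blast
  then show "\<exists>z\<in>?Z. z = y \<or> dominates_lexmax K z y"
    using A by (intro bexI[of _ "outcome_max w cat \<eta> K A"])
      (auto simp: y outcome_max_def dominates_lexmax_def)
qed blast

end

end

theorem corollary12:
  fixes E :: "'a set" and indep :: "'a set set" and r K :: nat
    and w :: "'a \<Rightarrow> nat" and \<eta> :: "nat \<Rightarrow> 'c::linorder" and cat :: "'a \<Rightarrow> 'c"
  assumes "matroid E indep"
    and "matroid_rank indep = r"
    and "strict_mono_on {1..K} \<eta>"
    and "cat \<in> E \<rightarrow> \<eta> ` {1..K}"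
  shows
    "(\<forall>S. (\<forall>u\<in>count_vectors K r. feasible_eq indep cat \<eta> K u \<noteq> {} \<longrightarrow>
              optimal w (feasible_eq indep cat \<eta> K u) (S u)) \<longrightarrow>
        nd_MMPO indep w cat =
          nondominated dominates_ord
            {outcome_ord w cat (S u) | u.
               u \<in> count_vectors K r \<and> feasible_eq indep cat \<eta> K u \<noteq> {}}) \<and>
     (\<forall>S. (\<forall>u\<in>count_vectors K r. feasible_le indep cat \<eta> K u \<noteq> {} \<longrightarrow>
              optimal w (feasible_le indep cat \<eta> K u) (S u)) \<longrightarrow>
        nd_MMPO indep w cat =
          nondominated dominates_ord
            {outcome_ord w cat (S u) | u.
               u \<in> count_vectors K r \<and> feasible_le indep cat \<eta> K u \<noteq> {}}) \<and>
     nd_MMPCmin indep w cat \<eta> K =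
       nondominated (dominates_lexmin K)
         {outcome_min w cat \<eta> K B | B.
            B \<in> bases indep \<and> outcome_ord w cat B \<in> nd_MMPO indep w cat} \<and>
     nd_MMPCmax indep w cat \<eta> K =
       nondominated (dominates_lexmax K)
         {outcome_max w cat \<eta> K B | B.
            B \<in> bases indep \<and> outcome_ord w cat B \<in> nd_MMPO indep w cat}"
proof -
  interpret matroid E indep by (rule assms(1))
  note r = assms(2) and ax = assms(3,4)
  show ?thesis
  proof (intro conjI allI impI)
    fix S
    assume "\<forall>u\<in>count_vectors K r. feasible_eq indep cat \<eta> K u \<noteq> {} \<longrightarrow>
      optimal w (feasible_eq indep cat \<eta> K u) (S u)"
    then show "nd_MMPO indep w cat = nondominated dominates_ord
        {outcome_ord w cat (S u) | u. u \<in> count_vectors K r \<and> feasible_eq indep cat \<eta> K u \<noteq> {}}"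
      using nd_MMPO_eq_optimal[OF ax, of w S] unfolding r by blast
  next
    fix S
    assume S: "\<forall>u\<in>count_vectors K r. feasible_le indep cat \<eta> K u \<noteq> {} \<longrightarrow>
      optimal w (feasible_le indep cat \<eta> K u) (S u)"
    \<comment> \<open>Both problems have the same feasible sets for every \<open>u\<close>
      considered, so this claim is the previous one.\<close>
    have le: "feasible_le indep cat \<eta> K u = feasible_eq indep cat \<eta> K u"
      if "u \<in> count_vectors K r" for u
      using feasible_le_eq_feasible_eq[OF ax, of u] that unfolding r .
    have "{outcome_ord w cat (S u) | u. u \<in> count_vectors K r \<and> feasible_le indep cat \<eta> K u \<noteq> {}} =
        {outcome_ord w cat (S u) | u. u \<in> count_vectors K r \<and> feasible_eq indep cat \<eta> K u \<noteq> {}}"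
      using le by blast
    then show "nd_MMPO indep w cat = nondominated dominates_ord
        {outcome_ord w cat (S u) | u. u \<in> count_vectors K r \<and> feasible_le indep cat \<eta> K u \<noteq> {}}"
      using nd_MMPO_eq_optimal[OF ax, of w S] S le unfolding r by simp
  qed (rule nd_MMPCmin_eq[OF ax] nd_MMPCmax_eq[OF ax])+
qed

end
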